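(* Let $k>\ell$ be positive integers, let $(\Phi_m)_{m\ge1}$ be a Følner sequence in $(\mathbb{N},\cdot)$, and let $0<\delta\le1$. Suppose there are infinitely many $m$ such that $\Phi_m$ contains a $(k,\ell)$-sum-free subset of size at least $\delta|\Phi_m|$. Then there exists a $(k,\ell)$-sum-free set $A\subseteq\mathbb{N}$ with $\widetilde{d}(A)\ge\delta$.
   Context: $\mathbb{N}$ is the set of nonnegative integers. A Følner sequence in $(\mathbb{N},\cdot)$ is a sequence $(\Phi_m)$ of finite nonempty subsets of $\mathbb{N}$ such that for every positive integer $a$, $\lim_{m\to\infty}|\Phi_m\,\triangle\,(a\cdot\Phi_m)|/|\Phi_m|=0$, where $a\cdot\Phi_m=\{a x:x\in\Phi_m\}$. A set $S$ is $(k,\ell)$-sum-free if for all (not necessarily distinct) $x_1,\dots,x_k,y_1,\dots,y_\ell\in S$ one has $x_1+\dots+x_k\neq y_1+\dots+y_\ell$. The upper density on multiples is $\widetilde{d}(A)=\limsup_{N\to\infty}\limsup_{n\to\infty}\frac{|A\cap (N!\cdot\{1,\dots,n\})|}{n}$. *)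

theory Defs
  imports "HOL-Analysis.Analysis"
begin

(* The sequence is indexed by m \<ge> 1; the value at index 0 is irrelevant. *)
definition mult_Folner_seq :: "(nat \<Rightarrow> nat set) \<Rightarrow> bool" where
  "mult_Folner_seq \<Phi> \<longleftrightarrow>
     (\<forall>m\<ge>1. finite (\<Phi> m) \<and> \<Phi> m \<noteq> {}) \<and>
     (\<forall>a::nat. a > 0 \<longrightarrow>
        (\<lambda>m. real (card (sym_diff (\<Phi> m) ((*) a ` \<Phi> m))) / real (card (\<Phi> m))) \<longlonglongrightarrow> 0)"

definition kl_sum_free :: "nat \<Rightarrow> nat \<Rightarrow> nat set \<Rightarrow> bool" where
  "kl_sum_free k l S \<longleftrightarrow>
     (\<forall>x y :: nat \<Rightarrow> nat. (\<forall>i\<in>{1..k}. x i \<in> S) \<and> (\<forall>j\<in>{1..l}. y j \<in> S)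
        \<longrightarrow> (\<Sum>i=1..k. x i) \<noteq> (\<Sum>j=1..l. y j))"

(* Taken in ereal, where limsup is total; all the quotients lie in [0,1]. *)
definition upper_density_on_multiples :: "nat set \<Rightarrow> ereal" where
  "upper_density_on_multiples A =
     limsup (\<lambda>N. limsup (\<lambda>n. ereal (real (card (A \<inter> (*) (fact N) ` {1..n})) / real n)))"

end

theory Submission
  imports Defs "HOL-Probability.Probability"
begin

text \<open>
  Choosing \<open>x\<close> uniformly from \<open>\<Phi> m\<close>, the set \<open>{a. a * x \<in> S}\<close> is a random sum-free set which,
  by the Folner property, contains each fixed positive \<open>a\<close> with probability at least \<open>\<delta> - o(1)\<close>.
  By compactness a subsequence of these random sets has a limit in distribution, which is almost
  surely sum-free and contains each positive \<open>a\<close> with probability at least \<open>\<delta>\<close>.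
  By the reverse Fatou lemma, its expected upper density on multiples is at least \<open>\<delta>\<close>.
\<close>

section \<open>Limits of random sets of natural numbers\<close>

text \<open>The point of the middle-thirds Cantor set whose ternary digits are 0 and 2. A random set
  thereby becomes a real random variable, so that compactness can come from weak convergence on the
  line.\<close>

definition cantor_val :: "nat set \<Rightarrow> real" where
  "cantor_val A = (\<Sum>n. 2 * of_bool (n \<in> A) / 3 ^ Suc n)"

text \<open>
  On the middle-thirds Cantor set this is the leading ternary digit divided by 2; extending it
  continuously to the whole line makes it usable as a test function for weak convergence.
\<close>

definition cantor_head :: "real \<Rightarrow> real" where
  "cantor_head y = max 0 (min 1 (3 * y - 1))"

text \<open>On the Cantor set, \<open>3 * y - 2 * cantor_head y\<close> deletes the leading ternary
  digit. Each digit thus stays a continuous function on the whole line.\<close>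

fun cantor_digit :: "nat \<Rightarrow> real \<Rightarrow> real" where
  "cantor_digit 0 y = cantor_head y"
| "cantor_digit (Suc n) y = cantor_digit n (3 * y - 2 * cantor_head y)"

lemma summable_cantor: "summable (\<lambda>n. 2 * of_bool (n \<in> A) / 3 ^ Suc n :: real)"
proof (rule summable_comparison_test')
  show "summable (\<lambda>n. 2 / 3 * (1 / 3) ^ n :: real)"
    by (intro summable_mult summable_geometric) auto
qed (auto simp: power_divide)

lemma cantor_val_bounds: "cantor_val A \<in> {0..1}"
proof -
  have "(\<lambda>n. 2 / 3 * (1 / 3) ^ n) sums (2 / 3 * (1 / (1 - 1 / 3 :: real)))"
    by (intro sums_mult geometric_sums) auto
  then have s: "(\<lambda>n. 2 / 3 * (1 / 3) ^ n) sums (1 :: real)"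
    by simp
  have "cantor_val A \<le> (\<Sum>n. 2 / 3 * (1 / 3) ^ n)"
    unfolding cantor_val_def
    by (intro suminf_le summable_cantor sums_summable[OF s]) (auto simp: power_divide)
  moreover have "0 \<le> cantor_val A"
    unfolding cantor_val_def by (intro suminf_nonneg summable_cantor) auto
  ultimately show ?thesis
    using sums_unique[OF s] by simp
qed

lemma cantor_val_rec: "cantor_val A = (2 * of_bool (0 \<in> A) + cantor_val {n. Suc n \<in> A}) / 3"
proof -
  have "cantor_val A = 2 * of_bool (0 \<in> A) / 3
      + (\<Sum>n. 2 * of_bool (Suc n \<in> A) / 3 ^ Suc (Suc n))"
    unfolding cantor_val_def using suminf_split_head[OF summable_cantor[of A]] by simp
  also have "(\<Sum>n. 2 * of_bool (Suc n \<in> A) / 3 ^ Suc (Suc n)) = cantor_val {n. Suc n \<in> A} / 3"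
    unfolding cantor_val_def
    by (subst suminf_divide[OF summable_cantor, symmetric]) (simp add: field_simps)
  finally show ?thesis
    by (simp add: add_divide_distrib)
qed

text \<open>By self-similarity the value lies in [0, 1/3] or in [2/3, 1], where the clipping in
  \<open>cantor_head\<close> returns exactly 0 or 1.\<close>

lemma cantor_head_val: "cantor_head (cantor_val A) = of_bool (0 \<in> A)"
  using cantor_val_bounds[of "{n. Suc n \<in> A}"] cantor_val_rec[of A]
  by (auto simp: cantor_head_def)

lemma cantor_digit_val: "cantor_digit n (cantor_val A) = of_bool (n \<in> A)"
proof (induction n arbitrary: A)
  case 0
  show ?case by (simp add: cantor_head_val)
next
  case (Suc n)
  have "3 * cantor_val A - 2 * cantor_head (cantor_val A) = cantor_val {n. Suc n \<in> A}"
    using cantor_val_rec[of A] by (simp add: cantor_head_val)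
  then show ?case
    using Suc.IH[of "{n. Suc n \<in> A}"] by simp
qed

lemma cantor_digit_bounds: "0 \<le> cantor_digit n y" "cantor_digit n y \<le> 1"
  by (induction n arbitrary: y) (auto simp: cantor_head_def)

lemma continuous_cantor_digit: "continuous_on UNIV (cantor_digit n)"
proof (induction n)
  case 0
  have "continuous_on UNIV (\<lambda>y. max 0 (min 1 (3 * y - 1 :: real)))"
    by (intro continuous_intros)
  then show ?case by (simp add: cantor_head_def)
next
  case (Suc n)
  have "continuous_on UNIV (\<lambda>y. 3 * y - 2 * cantor_head y)"
    unfolding cantor_head_def by (intro continuous_intros)
  then have "continuous_on UNIV (\<lambda>y. cantor_digit n (3 * y - 2 * cantor_head y))"
    by (rule continuous_on_compose2[OF Suc.IH]) auto
  then show ?case by simp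
qed

text \<open>The laws of the Cantor codes live on [0, 1], hence are tight and have a weakly
  convergent subsequence. Products of digits are bounded continuous test functions that equal the
  indicator of \<open>F \<subseteq> A\<close> on codes. The limit is recorded only through weights
  \<open>g a\<close> in [0, 1], which need not be 0 or 1 everywhere.\<close>

lemma random_set_limit:
  fixes p :: "nat \<Rightarrow> nat set pmf"
  obtains r M g where "strict_mono (r :: nat \<Rightarrow> nat)" "prob_space (M :: real measure)"
    "\<And>a. g a \<in> borel_measurable M" "\<And>a y. 0 \<le> g a y" "\<And>a y. g a y \<le> (1 :: real)"
    "\<And>F. finite F \<Longrightarrow> (\<lambda>n. measure_pmf.prob (p (r n)) {A. F \<subseteq> A})
      \<longlonglongrightarrow> (\<integral>y. (\<Prod>a\<in>F. g a y) \<partial>M)"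
proof -
  define \<mu> where "\<mu> n = distr (measure_pmf (p n)) borel cantor_val" for n
  have \<mu>: "real_distribution (\<mu> n)" for n
    unfolding \<mu>_def by (intro prob_space.real_distribution_distr prob_space_measure_pmf) simp
  \<comment> \<open>Tightness is stated with intervals open on the left; starting at -1 keeps 0, the
    code of the empty set, inside.\<close>
  have "measure (\<mu> n) {-1<..1} = 1" for n
  proof -
    have "cantor_val -` {-1<..1} = UNIV"
    proof (intro equalityI subsetI)
      fix A :: "nat set"
      show "A \<in> cantor_val -` {-1<..1}"
        using cantor_val_bounds[of A] by simp
    qed simp
    then show ?thesis
      unfolding \<mu>_def by (subst measure_distr) auto
  qed
  then have "tight \<mu>"
    unfolding tight_def using \<mu> by (intro conjI allI impI exI[of _ "-1"] exI[of _ 1]) auto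
  then obtain r M where r: "strict_mono (r :: nat \<Rightarrow> nat)" and M: "real_distribution M"
    and w: "weak_conv_m (\<mu> \<circ> id \<circ> r) M"
    using tight_imp_convergent_subsubsequence[of \<mu> id] by (auto simp: strict_mono_def)
  interpret M: real_distribution M by fact
  have lim: "(\<lambda>n. measure_pmf.prob (p (r n)) {A. F \<subseteq> A})
      \<longlonglongrightarrow> (\<integral>y. (\<Prod>a\<in>F. cantor_digit a y) \<partial>M)" if F: "finite F" for F
  proof -
    let ?f = "\<lambda>y. \<Prod>a\<in>F. cantor_digit a y"
    have cont: "continuous_on UNIV ?f"
      by (intro continuous_on_prod continuous_cantor_digit)
    have "norm (?f y) \<le> 1" for y
      by (auto simp: abs_prod cantor_digit_bounds intro!: prod_le_1)
    then have "(\<lambda>n. integral\<^sup>L ((\<mu> \<circ> id \<circ> r) n) ?f) \<longlonglongrightarrow> integral\<^sup>L M ?f"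
      using cont \<mu> M w
      by (intro weak_conv_imp_integral_bdd_continuous_conv[where B = 1])
         (auto simp: continuous_on_eq_continuous_at comp_def)
    moreover have "integral\<^sup>L ((\<mu> \<circ> id \<circ> r) n) ?f = measure_pmf.prob (p (r n)) {A. F \<subseteq> A}" for n
    proof -
      have "integral\<^sup>L ((\<mu> \<circ> id \<circ> r) n) ?f = (\<integral>A. ?f (cantor_val A) \<partial>measure_pmf (p (r n)))"
        unfolding \<mu>_def comp_def id_def using borel_measurable_continuous_onI[OF cont]
        by (subst integral_distr) auto
      also have "\<dots> = (\<integral>A. indicator {A. F \<subseteq> A} A \<partial>measure_pmf (p (r n)))"
      proof (intro Bochner_Integration.integral_cong refl)
        fix A
        show "?f (cantor_val A) = indicator {A. F \<subseteq> A} A"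
          using F by (auto simp: cantor_digit_val indicator_def intro!: prod.neutral)
      qed
      finally show ?thesis by simp
    qed
    ultimately show ?thesis by simp
  qed
  have "cantor_digit a \<in> borel_measurable M" for a
    using borel_measurable_continuous_onI[OF continuous_cantor_digit]
      measurable_cong_sets[OF M.events_eq_borel refl] by auto
  then show thesis
    by (intro that[OF r M.prob_space_axioms _ _ _ lim] cantor_digit_bounds)
qed

section \<open>Density of a random set\<close>

text \<open>Monotone continuous maps commute with limsup. This links the \<open>ereal\<close>
  density to the \<open>ennreal\<close> integrals of the reverse Fatou lemma.\<close>

lemma e2ennreal_limsup: "limsup (\<lambda>n. e2ennreal (f n)) = e2ennreal (limsup f)"
  by (rule Limsup_compose_continuous_mono)
     (auto simp: continuous_on_e2ennreal mono_def e2ennreal_mono)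

text \<open>Otherwise \<open>f < c\<close> almost surely, and as \<open>c\<close> is finite and the
  total mass is 1, the integral would be strictly below \<open>c\<close>.\<close>

lemma (in prob_space) exists_nn_integral_le:
  assumes [measurable]: "f \<in> borel_measurable M"
    and "c < \<infinity>" "c \<le> (\<integral>\<^sup>+x. f x \<partial>M)" "AE x in M. P x"
  shows "\<exists>x. P x \<and> c \<le> f x"
proof (rule ccontr)
  assume neg: "\<not> ?thesis"
  have lt: "AE x in M. f x < c"
    using assms(4) by eventually_elim (use neg in \<open>auto simp: not_le\<close>)
  then have le: "AE x in M. f x \<le> c"
    by eventually_elim auto
  have c: "(\<integral>\<^sup>+x. c \<partial>M) = c"
    by (simp add: emeasure_space_1)
  have "(\<integral>\<^sup>+x. f x \<partial>M) < (\<integral>\<^sup>+x. c \<partial>M)"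
  proof (rule nn_integral_less)
    show "(\<integral>\<^sup>+x. f x \<partial>M) \<noteq> \<infinity>"
      using nn_integral_mono_AE[OF le] assms(2) unfolding c by (auto simp: top_unique)
    show "\<not> (AE x in M. c \<le> f x)"
    proof
      assume "AE x in M. c \<le> f x"
      with lt have "AE x in M. False"
        by eventually_elim auto
      then show False
        by simp
    qed
  qed (use le in auto)
  then show False
    using assms(3) c by simp
qed

text \<open>Averages of the weights have mean at least \<open>\<delta>\<close>, and two uses of the
  reverse Fatou lemma move both limsups inside the expectation. Since the weights are at most 1,
  counting their support only increases the averages.\<close>

lemma (in prob_space) exists_upper_density_ge:
  fixes g :: "nat \<Rightarrow> 'a \<Rightarrow> real"
  assumes [measurable]: "\<And>a. g a \<in> borel_measurable M"
    and g: "\<And>a y. 0 \<le> g a y" "\<And>a y. g a y \<le> 1"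
    and mean: "\<And>a. 0 < a \<Longrightarrow> \<delta> \<le> expectation (g a)"
    and "0 < \<delta>" and P: "AE y in M. P y"
  shows "\<exists>y. P y \<and> ereal \<delta> \<le> upper_density_on_multiples {a. 0 < g a y}"
proof -
  define f where "f N n y = (\<Sum>i=1..n. g (fact N * i) y) / real n" for N n :: nat and y
  have [measurable]: "f N n \<in> borel_measurable M" for N n
    unfolding f_def by measurable
  have f0: "0 \<le> f N n y" for N n y
    unfolding f_def using g by (auto intro!: divide_nonneg_nonneg sum_nonneg)
  have f1: "f N n y \<le> 1" for N n y
  proof -
    have "(\<Sum>i=1..n. g (fact N * i) y) \<le> (\<Sum>i=1..n. 1)"
      by (intro sum_mono g)
    then show ?thesis
      unfolding f_def by (auto simp: divide_le_eq_1)
  qed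
  have intg: "integrable M (g a)" for a
    by (rule integrable_const_bound[of _ 1]) (use g in auto)
  \<comment> \<open>At \<open>n = 0\<close> the quotient is 0 by the convention for division, so the
    bound starts at \<open>n = 1\<close>.\<close>
  have Ef: "ennreal \<delta> \<le> (\<integral>\<^sup>+y. ennreal (f N n y) \<partial>M)" if "n \<ge> 1" for N n
  proof -
    have "real n * \<delta> = (\<Sum>i=1..n. \<delta>)"
      by simp
    also have "\<dots> \<le> (\<Sum>i=1..n. expectation (g (fact N * i)))"
      by (intro sum_mono mean) auto
    also have "\<dots> = real n * expectation (f N n)"
      unfolding f_def using that intg by (simp add: Bochner_Integration.integral_sum)
    finally have "\<delta> \<le> expectation (f N n)"
      using that by simp
    moreover have "integrable M (f N n)"
      by (rule integrable_const_bound[of _ 1]) (use f0 f1 in auto)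
    ultimately show ?thesis
      using f0 by (subst nn_integral_eq_integral) (auto intro: ennreal_leI)
  qed
  have fin: "(\<integral>\<^sup>+y. 1 \<partial>M) < \<infinity>"
    by (simp add: emeasure_space_1)
  have lim1: "ennreal \<delta> \<le> (\<integral>\<^sup>+y. limsup (\<lambda>n. ennreal (f N n y)) \<partial>M)" for N
  proof -
    \<comment> \<open>Reverse Fatou with the constant 1 as integrable majorant; the same majorant
      serves for the outer limsup below.\<close>
    have "ennreal \<delta> \<le> limsup (\<lambda>n. \<integral>\<^sup>+y. ennreal (f N n y) \<partial>M)"
      by (intro le_Limsup eventually_sequentiallyI[of 1] Ef) auto
    also have "\<dots> \<le> (\<integral>\<^sup>+y. limsup (\<lambda>n. ennreal (f N n y)) \<partial>M)"
      by (rule nn_integral_limsup[OF _ _ _ fin]) (use f1 in \<open>auto simp: ennreal_le_1\<close>)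
    finally show ?thesis .
  qed
  have "ennreal \<delta> \<le> limsup (\<lambda>N. \<integral>\<^sup>+y. limsup (\<lambda>n. ennreal (f N n y)) \<partial>M)"
    by (intro le_Limsup always_eventually allI lim1) auto
  also have "\<dots> \<le> (\<integral>\<^sup>+y. limsup (\<lambda>N. limsup (\<lambda>n. ennreal (f N n y))) \<partial>M)"
    by (rule nn_integral_limsup[OF _ _ _ fin])
       (use f1 in \<open>auto simp: ennreal_le_1 intro!: Limsup_bounded always_eventually\<close>)
  finally obtain y where y: "P y"
    "ennreal \<delta> \<le> limsup (\<lambda>N. limsup (\<lambda>n. ennreal (f N n y)))"
    using exists_nn_integral_le[OF _ _ _ P, where c = "ennreal \<delta>"
        and f = "\<lambda>y. limsup (\<lambda>N. limsup (\<lambda>n. ennreal (f N n y)))"] by auto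
  let ?A = "{a. 0 < g a y}"
  have "f N n y \<le> real (card (?A \<inter> (*) (fact N) ` {1..n})) / real n" for N n
  proof -
    have "(\<Sum>i=1..n. g (fact N * i) y) \<le> (\<Sum>i=1..n. of_bool (fact N * i \<in> ?A))"
      using g by (intro sum_mono) (auto simp: of_bool_def not_less)
    also have "\<dots> = real (card {i \<in> {1..n}. fact N * i \<in> ?A})"
      by (simp add: of_bool_def sum.If_cases Int_def)
    also have "card {i \<in> {1..n}. fact N * i \<in> ?A}
        = card ((*) (fact N) ` {i \<in> {1..n}. fact N * i \<in> ?A})"
      by (intro card_image[symmetric]) (auto simp: inj_on_def)
    also have "(*) (fact N) ` {i \<in> {1..n}. fact N * i \<in> ?A} = ?A \<inter> (*) (fact N) ` {1..n}"
      by auto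
    finally show ?thesis
      unfolding f_def by (intro divide_right_mono) auto
  qed
  then have "limsup (\<lambda>N. limsup (\<lambda>n. ereal (f N n y))) \<le> upper_density_on_multiples ?A"
    unfolding upper_density_on_multiples_def
    by (intro Limsup_mono always_eventually allI) simp
  then have "ennreal \<delta> \<le> e2ennreal (upper_density_on_multiples ?A)"
    using y(2) by (auto simp: e2ennreal_limsup simp flip: e2ennreal_ereal
        intro: order_trans e2ennreal_mono)
  \<comment> \<open>\<open>e2ennreal\<close> sends negative values to 0, so positivity of
    \<open>\<delta>\<close> is what permits the return to \<open>ereal\<close>.\<close>
  then have "ereal \<delta> \<le> upper_density_on_multiples ?A"
    using \<open>0 < \<delta>\<close>
    by (cases "upper_density_on_multiples ?A") (auto simp: ennreal_le_iff2 e2ennreal_neg)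
  with y(1) show ?thesis by blast
qed

section \<open>Sum-free sets and dilations\<close>

text \<open>A violating equation involves at most \<open>k + l\<close> elements. This finite
  character reduces sum-freeness of the random set to countably many events.\<close>

lemma kl_sum_free_finite_subsets:
  assumes "\<And>F. finite F \<Longrightarrow> F \<subseteq> A \<Longrightarrow> kl_sum_free k l F"
  shows "kl_sum_free k l A"
  unfolding kl_sum_free_def
proof (intro allI impI)
  fix x y :: "nat \<Rightarrow> nat"
  assume "(\<forall>i\<in>{1..k}. x i \<in> A) \<and> (\<forall>j\<in>{1..l}. y j \<in> A)"
  then have "kl_sum_free k l (x ` {1..k} \<union> y ` {1..l})"
    by (intro assms) auto
  then show "(\<Sum>i=1..k. x i) \<noteq> (\<Sum>j=1..l. y j)"
    unfolding kl_sum_free_def by blast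
qed

lemma kl_sum_free_subset:
  assumes "kl_sum_free k l A" "B \<subseteq> A"
  shows "kl_sum_free k l B"
  unfolding kl_sum_free_def
proof (intro allI impI)
  fix x y :: "nat \<Rightarrow> nat"
  assume "(\<forall>i\<in>{1..k}. x i \<in> B) \<and> (\<forall>j\<in>{1..l}. y j \<in> B)"
  then have "(\<forall>i\<in>{1..k}. x i \<in> A) \<and> (\<forall>j\<in>{1..l}. y j \<in> A)"
    using assms(2) by blast
  then show "(\<Sum>i=1..k. x i) \<noteq> (\<Sum>j=1..l. y j)"
    using assms(1) by (simp add: kl_sum_free_def)
qed

text \<open>Multiplying an equation by \<open>c\<close> preserves it. The case \<open>c = 0\<close>
  is included, as a Folner set may contain 0.\<close>

lemma kl_sum_free_dilation:
  assumes "kl_sum_free k l S"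
  shows "kl_sum_free k l {a. a * c \<in> S}"
  unfolding kl_sum_free_def
proof (intro allI impI)
  fix x y :: "nat \<Rightarrow> nat"
  assume "(\<forall>i\<in>{1..k}. x i \<in> {a. a * c \<in> S}) \<and> (\<forall>j\<in>{1..l}. y j \<in> {a. a * c \<in> S})"
  then have "(\<Sum>i=1..k. x i * c) \<noteq> (\<Sum>j=1..l. y j * c)"
    using assms unfolding kl_sum_free_def by (auto dest!: spec[of _ "\<lambda>i. x i * c"])
  then show "(\<Sum>i=1..k. x i) \<noteq> (\<Sum>j=1..l. y j)"
    by (metis sum_distrib_right)
qed

text \<open>An element of \<open>S\<close> either is \<open>a * x\<close> with \<open>x\<close> in
  \<open>\<Phi>\<close> or belongs to \<open>\<Phi>\<close> but not to its dilate; the second kind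
  is the Folner error.\<close>

lemma card_dilation_ge:
  fixes a :: nat
  assumes "finite \<Phi>" "S \<subseteq> \<Phi>" "0 < a"
  shows "card S \<le> card {x \<in> \<Phi>. a * x \<in> S} + card (sym_diff \<Phi> ((*) a ` \<Phi>))"
proof -
  have "S \<subseteq> (*) a ` {x \<in> \<Phi>. a * x \<in> S} \<union> sym_diff \<Phi> ((*) a ` \<Phi>)"
    using assms by auto
  then have "card S \<le> card ((*) a ` {x \<in> \<Phi>. a * x \<in> S} \<union> sym_diff \<Phi> ((*) a ` \<Phi>))"
    using assms(1) by (intro card_mono) auto
  also have "\<dots> \<le> card ((*) a ` {x \<in> \<Phi>. a * x \<in> S}) + card (sym_diff \<Phi> ((*) a ` \<Phi>))"
    by (rule card_Un_le)
  also have "card ((*) a ` {x \<in> \<Phi>. a * x \<in> S}) = card {x \<in> \<Phi>. a * x \<in> S}"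
    using assms(3) by (intro card_image) (auto simp: inj_on_def)
  finally show ?thesis .
qed

theorem theorem7p1:
  fixes k l :: nat and \<Phi> :: "nat \<Rightarrow> nat set" and \<delta> :: real
  assumes "0 < l" and "l < k"
    and "mult_Folner_seq \<Phi>"
    and "0 < \<delta>" and "\<delta> \<le> 1"
    and "infinite {m. m \<ge> 1 \<and>
           (\<exists>S\<subseteq>\<Phi> m. kl_sum_free k l S \<and> real (card S) \<ge> \<delta> * real (card (\<Phi> m)))}"
  shows "\<exists>A::nat set. kl_sum_free k l A \<and> upper_density_on_multiples A \<ge> ereal \<delta>"
proof -
  let ?I = "{m. m \<ge> 1 \<and>
           (\<exists>S\<subseteq>\<Phi> m. kl_sum_free k l S \<and> real (card S) \<ge> \<delta> * real (card (\<Phi> m)))}"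
  define s where "s = enumerate ?I"
  have s: "strict_mono s"
    unfolding s_def using assms(6) by (rule strict_mono_enumerate)
  have sI: "s n \<in> ?I" for n
    unfolding s_def using assms(6) by (rule enumerate_in_set)
  then have "\<forall>n. \<exists>S\<subseteq>\<Phi> (s n). kl_sum_free k l S \<and> real (card S) \<ge> \<delta> * real (card (\<Phi> (s n)))"
    by blast
  then obtain S where S: "\<And>n. S n \<subseteq> \<Phi> (s n)" "\<And>n. kl_sum_free k l (S n)"
    "\<And>n. real (card (S n)) \<ge> \<delta> * real (card (\<Phi> (s n)))"
    by metis
  have \<Phi>: "finite (\<Phi> (s n))" "\<Phi> (s n) \<noteq> {}" for n
    using assms(3) sI[of n] unfolding mult_Folner_seq_def by auto
  define p where "p n = map_pmf (\<lambda>x. {a. a * x \<in> S n}) (pmf_of_set (\<Phi> (s n)))" for n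
  obtain r M g where r: "strict_mono (r :: nat \<Rightarrow> nat)" and M: "prob_space (M :: real measure)"
    and g_meas: "\<And>a. g a \<in> borel_measurable M"
    and g: "\<And>a y. 0 \<le> g a y" "\<And>a y. g a y \<le> (1 :: real)"
    and lim: "\<And>F. finite F \<Longrightarrow> (\<lambda>n. measure_pmf.prob (p (r n)) {A. F \<subseteq> A})
      \<longlonglongrightarrow> (\<integral>y. (\<Prod>a\<in>F. g a y) \<partial>M)"
    using random_set_limit[of p] by metis
  interpret prob_space M by fact
  note g_meas[measurable]
  have mean: "\<delta> \<le> expectation (g a)" if a: "0 < a" for a
  proof -
    define e where "e m = real (card (sym_diff (\<Phi> m) ((*) a ` \<Phi> m))) / real (card (\<Phi> m))" for m
    have "e \<longlonglongrightarrow> 0"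
      using assms(3) a unfolding mult_Folner_seq_def e_def by blast
    then have "(\<lambda>n. e ((s \<circ> r) n)) \<longlonglongrightarrow> 0"
      using LIMSEQ_subseq_LIMSEQ[OF _ strict_mono_o[OF s r]] by (auto simp: comp_def)
    then have "(\<lambda>n. \<delta> - e (s (r n))) \<longlonglongrightarrow> \<delta>"
      by (auto intro!: tendsto_eq_intros)
    moreover have "(\<lambda>n. measure_pmf.prob (p (r n)) {A. {a} \<subseteq> A}) \<longlonglongrightarrow> expectation (g a)"
      using lim[of "{a}"] by simp
    \<comment> \<open>The probability that \<open>a\<close> lies in the random set is the proportion
      of \<open>x\<close> in \<open>\<Phi> (s n)\<close> with \<open>a * x\<close> in
      \<open>S n\<close>, which falls short of \<open>\<delta>\<close> by at most the Folner
      ratio.\<close>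
    moreover have "\<delta> - e (s n) \<le> measure_pmf.prob (p n) {A. {a} \<subseteq> A}" for n
    proof -
      have pos: "0 < real (card (\<Phi> (s n)))"
        using \<Phi>[of n] by (simp add: card_gt_0_iff)
      have "\<delta> * real (card (\<Phi> (s n))) \<le> real (card {x \<in> \<Phi> (s n). a * x \<in> S n})
          + real (card (sym_diff (\<Phi> (s n)) ((*) a ` \<Phi> (s n))))"
        using card_dilation_ge[OF \<Phi>(1)[of n] S(1)[of n] a] S(3)[of n] by linarith
      then have "\<delta> \<le> real (card {x \<in> \<Phi> (s n). a * x \<in> S n}) / real (card (\<Phi> (s n))) + e (s n)"
        unfolding e_def using pos by (simp add: field_simps)
      moreover have "measure_pmf.prob (p n) {A. {a} \<subseteq> A}
          = real (card {x \<in> \<Phi> (s n). a * x \<in> S n}) / real (card (\<Phi> (s n)))"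
        unfolding p_def using \<Phi>[of n] by (simp add: measure_pmf_of_set Int_def)
      ultimately show ?thesis by linarith
    qed
    ultimately show ?thesis
      by (intro LIMSEQ_le) auto
  qed
  \<comment> \<open>A sum-free set never contains such an \<open>F\<close>, so the limiting integral
    vanishes; its integrand is nonnegative and hence null almost surely.\<close>
  have zero: "AE y in M. (\<Prod>a\<in>F. g a y) = 0" if F: "finite F" "\<not> kl_sum_free k l F" for F
  proof -
    have "measure_pmf.prob (p n) {A. F \<subseteq> A} = 0" for n
      unfolding p_def measure_pmf_zero_iff
      using F(2) kl_sum_free_subset[OF kl_sum_free_dilation[OF S(2)]] by auto
    then have "(\<integral>y. (\<Prod>a\<in>F. g a y) \<partial>M) = 0"
      using LIMSEQ_unique[OF lim[OF F(1)]] by simp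
    moreover have "integrable M (\<lambda>y. \<Prod>a\<in>F. g a y)"
      by (rule integrable_const_bound[of _ 1]) (use g in \<open>auto simp: abs_prod intro!: prod_le_1\<close>)
    ultimately show ?thesis
      using g by (subst (asm) integral_nonneg_eq_0_iff_AE) (auto intro!: prod_nonneg)
  qed
  \<comment> \<open>There are only countably many finite sets of naturals, so one null set serves
    for all \<open>F\<close>.\<close>
  have "AE y in M. \<forall>F\<in>{F. finite F \<and> \<not> kl_sum_free k l F}. (\<Prod>a\<in>F. g a y) = 0"
  proof (subst AE_ball_countable)
    show "countable {F. finite F \<and> \<not> kl_sum_free k l F}"
      by (rule countable_subset[OF _ countable_Collect_finite]) auto
  qed (use zero in auto)
  then have "AE y in M. kl_sum_free k l {a. 0 < g a y}"
  proof eventually_elim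
    case (elim y)
    \<comment> \<open>A finite subset of the support has a positive product of weights, so outside
      the null set it must be sum-free.\<close>
    show ?case
    proof (rule kl_sum_free_finite_subsets, rule ccontr)
      fix F
      assume F: "finite F" "F \<subseteq> {a. 0 < g a y}" "\<not> kl_sum_free k l F"
      then have "(\<Prod>a\<in>F. g a y) > 0"
        by (intro prod_pos) auto
      with elim F show False by force
    qed
  qed
  then have "\<exists>y. kl_sum_free k l {a. 0 < g a y}
      \<and> ereal \<delta> \<le> upper_density_on_multiples {a. 0 < g a y}"
    using g_meas g mean assms(4) by (intro exists_upper_density_ge)
  then obtain y where "kl_sum_free k l {a. 0 < g a y}"
    "ereal \<delta> \<le> upper_density_on_multiples {a. 0 < g a y}"
    by (elim exE conjE)
  then show ?thesis
    by (intro exI[of _ "{a. 0 < g a y}"] conjI)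
qed

end
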